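(* Let $K$ be a field of characteristic different from $2$ and let $q(x)\in K[x]$ be a 2-division quartic over $K$ which is not of the form $(x-s)^4$. Then the following are equivalent: (1) $e(q)=0$. (2) $q$ is the 2-division quartic of a nontrivial 2-torsion point on a plane cubic (in Weierstrass form over $K$) which may be singular. (3) $q$ has two double roots, i.e. $q(x)=(x-s)^2(x-t)^2$ with $s\neq t$ in an algebraic closure $\bar K$ of $K$.
   Context: For a monic quartic $q(x)=x^4+d_3x^3+d_2x^2+d_1x+d_0$ put $e(q):=8d_1-4d_2d_3+d_3^3$. A pair $(C,P_2)$ over $K$ consists of a plane cubic $C = \{y^2 = x^3 + ax^2 + bx + c\}$ with $a,b,c\in K$ (together with its point at infinity $O=(0:1:0)$), which may be singular, and a $K$-rational point $P_2=(x_2,y_2)\in C(K)\setminus\{O\}$, which may be a singular point of $C$. The 2-division quartic of $(C,P_2)$ is $$x^4 - 4x_2x^3 - (2b+4ax_2)x^2 - (8c+4bx_2)x + (b^2-4ac-4cx_2),$$ and a 2-division quartic over $K$ is a quartic arising in this way from some pair over $K$. The smooth points of $C$ form an abelian group under the chord-and-tangent law with identity $O$ and $-(x,y)=(x,-y)$; a nontrivial 2-torsion point is a smooth point $P\neq O$ with $2P=O$ in this group. *)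

theory Defs
  imports "HOL-Algebra.Algebraic_Closure_Type" "HOL-Computational_Algebra.Polynomial"
begin

text \<open>
  The cubic \<open>y\<^sup>2 = x\<^sup>3 + a x\<^sup>2 + b x + c\<close> is given by its coefficients. No condition is
  imposed on the discriminant, so the cubic may be singular.
\<close>

datatype 'a wpoint = Infinity | Affine 'a 'a

definition cubic_rhs :: "'a::field \<Rightarrow> 'a \<Rightarrow> 'a \<Rightarrow> 'a poly" where
  "cubic_rhs a b c = [:c, b, a, 1:]"

fun on_cubic :: "'a::field \<Rightarrow> 'a \<Rightarrow> 'a \<Rightarrow> 'a wpoint \<Rightarrow> bool" where
  "on_cubic a b c Infinity \<longleftrightarrow> True"
| "on_cubic a b c (Affine x y) \<longleftrightarrow> y ^ 2 = poly (cubic_rhs a b c) x"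

text \<open>
  An affine point is smooth iff one of the two partial derivatives of
  \<open>y\<^sup>2 - (x\<^sup>3 + a x\<^sup>2 + b x + c)\<close> does not vanish there; the point at infinity is always smooth.
\<close>

fun smooth_point :: "'a::field \<Rightarrow> 'a \<Rightarrow> 'a \<Rightarrow> 'a wpoint \<Rightarrow> bool" where
  "smooth_point a b c Infinity \<longleftrightarrow> True"
| "smooth_point a b c (Affine x y) \<longleftrightarrow>
     on_cubic a b c (Affine x y) \<and>
     (2 * y \<noteq> 0 \<or> - poly (pderiv (cubic_rhs a b c)) x \<noteq> 0)"

text \<open>
  Slope of the chord through two affine points, or of the tangent line at \<open>(x\<^sub>1, y\<^sub>1)\<close> if they
  coincide; it is only meaningful when that line is not vertical.
\<close>

definition line_slope :: "'a::field \<Rightarrow> 'a \<Rightarrow> 'a \<Rightarrow> 'a \<Rightarrow> 'a \<Rightarrow> 'a \<Rightarrow> 'a \<Rightarrow> 'a" where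
  "line_slope a b c x1 y1 x2 y2 =
     (if x1 = x2 then poly (pderiv (cubic_rhs a b c)) x1 / (2 * y1)
      else (y2 - y1) / (x2 - x1))"

text \<open>
  The line meets the cubic in a third point with abscissa \<open>m\<^sup>2 - a - x\<^sub>1 - x\<^sub>2\<close>; its reflection in
  the x-axis is the sum. A vertical line has its third intersection at infinity. The law is
  intended for smooth points of a cubic in characteristic different from 2; other values are
  irrelevant.
\<close>

fun wadd :: "'a::field \<Rightarrow> 'a \<Rightarrow> 'a \<Rightarrow> 'a wpoint \<Rightarrow> 'a wpoint \<Rightarrow> 'a wpoint" where
  "wadd a b c Infinity Q = Q"
| "wadd a b c P Infinity = P"
| "wadd a b c (Affine x1 y1) (Affine x2 y2) =
     (if x1 = x2 \<and> y1 = - y2 then Infinity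
      else let m = line_slope a b c x1 y1 x2 y2;
               x3 = m ^ 2 - a - x1 - x2
           in Affine x3 (- (y1 + m * (x3 - x1))))"

text \<open>
  Intersecting the cubic with a non-vertical chord or tangent: the residual intersection has the
  abscissa used in \<^const>\<open>wadd\<close>, with multiplicities counted.
\<close>

lemma line_cubic_intersection:
  fixes a b c :: "'a::field"
  assumes "(2::'a) \<noteq> 0"
    and "on_cubic a b c (Affine x1 y1)" "on_cubic a b c (Affine x2 y2)"
    and "\<not> (x1 = x2 \<and> y1 = - y2)"
  defines "m \<equiv> line_slope a b c x1 y1 x2 y2"
  shows "cubic_rhs a b c - [:y1 - m * x1, m:] ^ 2 =
           [:- x1, 1:] * [:- x2, 1:] * [:- (m ^ 2 - a - x1 - x2), 1:]"
proof -
  have 1: "y1 ^ 2 = x1 ^ 3 + a * x1 ^ 2 + b * x1 + c"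
    and 2: "y2 ^ 2 = x2 ^ 3 + a * x2 ^ 2 + b * x2 + c"
    using assms(2,3) by (simp_all add: cubic_rhs_def power2_eq_square power3_eq_cube algebra_simps)
  have key: "b - 2 * m * (y1 - m * x1) = x1 * x2 + (x1 + x2) * (m ^ 2 - a - x1 - x2)"
  proof (cases "x1 = x2")
    case True
    then have "(y1 - y2) * (y1 + y2) = 0" using 1 2 by (simp add: algebra_simps power2_eq_square)
    with True assms(4) have "y1 = y2" "y1 \<noteq> - y1"
      by (auto simp: eq_neg_iff_add_eq_0)
    then have "y1 \<noteq> 0" by auto
    with assms(1) True have "2 * y1 * m = poly (pderiv (cubic_rhs a b c)) x1"
      unfolding m_def line_slope_def by simp
    then have "b = 2 * y1 * m - 3 * x1 ^ 2 - 2 * a * x1"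
      by (simp add: cubic_rhs_def pderiv_pCons power2_eq_square algebra_simps)
    with True show ?thesis by (simp add: power2_eq_square algebra_simps)
  next
    case False
    then have "m * (x2 - x1) = y2 - y1" unfolding m_def line_slope_def by simp
    then have y2_eq: "y2 = y1 + m * (x2 - x1)" by simp
    have "(x2 - x1) * (2 * y1 * m + m ^ 2 * (x2 - x1)) = y2 ^ 2 - y1 ^ 2"
      unfolding y2_eq by (simp add: power2_eq_square algebra_simps)
    also have "\<dots> = (x2 - x1) * (x1 ^ 2 + x1 * x2 + x2 ^ 2 + a * (x1 + x2) + b)"
      unfolding 1 2 by (simp add: power2_eq_square power3_eq_cube algebra_simps)
    finally have "2 * y1 * m + m ^ 2 * (x2 - x1) = x1 ^ 2 + x1 * x2 + x2 ^ 2 + a * (x1 + x2) + b"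
      using False by simp
    then have "b = 2 * y1 * m + m ^ 2 * (x2 - x1) - x1 ^ 2 - x1 * x2 - x2 ^ 2 - a * (x1 + x2)"
      by simp
    then show ?thesis by (simp add: power2_eq_square algebra_simps)
  qed
  have "c = y1 ^ 2 - x1 ^ 3 - a * x1 ^ 2 - b * x1" using 1 by simp
  then have "c - (y1 - m * x1) ^ 2 =
      - x1 * (b - 2 * m * (y1 - m * x1)) + x1 ^ 2 * (m ^ 2 - a - x1)"
    by (simp add: power2_eq_square power3_eq_cube algebra_simps)
  also have "\<dots> = - x1 * x2 * (m ^ 2 - a - x1 - x2)"
    unfolding key by (simp add: power2_eq_square algebra_simps)
  finally have const: "c - (y1 - m * x1) ^ 2 = - x1 * x2 * (m ^ 2 - a - x1 - x2)" .
  have "cubic_rhs a b c - [:y1 - m * x1, m:] ^ 2 =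
      [:c - (y1 - m * x1) ^ 2, b - 2 * m * (y1 - m * x1), a - m ^ 2, 1:]"
    by (simp add: cubic_rhs_def power2_eq_square algebra_simps)
  then show ?thesis
    unfolding const key by (simp add: power2_eq_square algebra_simps)
qed

definition nontrivial_2_torsion :: "'a::field \<Rightarrow> 'a \<Rightarrow> 'a \<Rightarrow> 'a wpoint \<Rightarrow> bool" where
  "nontrivial_2_torsion a b c P \<longleftrightarrow>
     smooth_point a b c P \<and> P \<noteq> Infinity \<and> wadd a b c P P = Infinity"

text \<open>The quartic of the cubic \<open>(a, b, c)\<close> and a point with abscissa \<open>x\<^sub>2\<close>, lowest coefficient first.\<close>

definition two_division_quartic :: "'a::field \<Rightarrow> 'a \<Rightarrow> 'a \<Rightarrow> 'a \<Rightarrow> 'a poly" where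
  "two_division_quartic a b c x2 =
     [:b ^ 2 - 4 * a * c - 4 * c * x2, - (8 * c + 4 * b * x2), - (2 * b + 4 * a * x2), - 4 * x2, 1:]"

definition is_two_division_quartic :: "'a::field poly \<Rightarrow> bool" where
  "is_two_division_quartic q \<longleftrightarrow>
     (\<exists>a b c x2 y2. on_cubic a b c (Affine x2 y2) \<and> q = two_division_quartic a b c x2)"

text \<open>For a monic quartic \<open>x\<^sup>4 + d\<^sub>3 x\<^sup>3 + d\<^sub>2 x\<^sup>2 + d\<^sub>1 x + d\<^sub>0\<close>.\<close>

definition quartic_e :: "'a::field poly \<Rightarrow> 'a" where
  "quartic_e q = 8 * coeff q 1 - 4 * coeff q 2 * coeff q 3 + coeff q 3 ^ 3"

end

theory Submission
  imports Defs
begin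

text \<open>
  Everything rests on two identities for the cubic \<open>f = x\<^sup>3 + a x\<^sup>2 + b x + c\<close> and a point
  \<open>(x\<^sub>2, y\<^sub>2)\<close> on \<open>y\<^sup>2 = f(x)\<close>, with division quartic \<open>q\<close>. The first is \<open>e(q) = - 64 f(x\<^sub>2)\<close>
  (\<open>quartic_e_two_division_quartic\<close>), so that, 2 being invertible, \<open>e(q)\<close> vanishes exactly when
  \<open>y\<^sub>2 = 0\<close>. The second says that in this case \<open>q = ((x - x\<^sub>2)\<^sup>2 - f'(x\<^sub>2))\<^sup>2\<close>
  (\<open>two_division_quartic_at_root\<close>).

  A point with \<open>y\<^sub>2 = 0\<close> is killed by doubling, and it is smooth iff \<open>f'(x\<^sub>2) \<noteq> 0\<close>. By the second
  identity, \<open>f'(x\<^sub>2) = 0\<close> means \<open>q = (x - x\<^sub>2)\<^sup>4\<close>, the excluded case. Otherwise the roots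
  \<open>x\<^sub>2 \<plusminus> \<surd>f'(x\<^sub>2)\<close> of \<open>q\<close> are distinct and double. Conversely, \<open>e\<close> vanishes on the square of
  every monic quadratic (\<open>quartic_e_square\<close>), and \<open>e\<close> commutes with the embedding into the
  algebraic closure, so two double roots there force \<open>e(q) = 0\<close>.
\<close>

lemma two_neq_zero_if_CHAR_neq_2:
  assumes "CHAR('a::field) \<noteq> 2"
  shows "(2::'a) \<noteq> 0"
proof
  assume "(2::'a) = 0"
  then have "of_nat 2 = (0::'a)" by simp
  then have "CHAR('a) dvd 2" by (simp only: of_nat_eq_0_iff_char_dvd)
  moreover have "prime (2::nat)" by simp
  ultimately have "CHAR('a) = 1 \<or> CHAR('a) = 2" by (auto simp: prime_nat_iff)
  with assms show False by simp
qed

lemma quartic_e_two_division_quartic: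
  "quartic_e (two_division_quartic a b c x) = - 64 * poly (cubic_rhs a b c) x"
  by (simp add: quartic_e_def two_division_quartic_def cubic_rhs_def eval_nat_numeral algebra_simps)

text \<open>
  The quartic is compatible with translating the abscissa. Moving the root \<open>x\<close> to the origin makes
  the constant term of the cubic vanish and turns its linear coefficient into the derivative
  \<open>d\<close> at \<open>x\<close>, which leaves \<open>X\<^sup>4 - 2 d X\<^sup>2 + d\<^sup>2\<close>.
\<close>

lemma two_division_quartic_at_root:
  assumes "poly (cubic_rhs a b c) x = 0"
  shows "two_division_quartic a b c x =
    ([:- x, 1:] ^ 2 - [:poly (pderiv (cubic_rhs a b c)) x:]) ^ 2"
proof -
  have c: "c = - (x ^ 3 + a * x ^ 2 + b * x)"
    using assms by (simp add: cubic_rhs_def eval_nat_numeral algebra_simps eq_neg_iff_add_eq_0)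
  show ?thesis
    unfolding two_division_quartic_def c
    by (simp add: cubic_rhs_def pderiv_pCons eval_nat_numeral algebra_simps)
qed

lemma quartic_e_square: "quartic_e ([:r, p, 1:] ^ 2) = 0"
  by (simp add: quartic_e_def eval_nat_numeral algebra_simps)

lemma quartic_e_map_poly_to_ac: "quartic_e (map_poly to_ac q) = to_ac (quartic_e q)"
  by (simp add: quartic_e_def coeff_map_poly)

lemma nontrivial_2_torsion_Affine_iff:
  fixes a b c x y :: "'a::field"
  assumes "(2::'a) \<noteq> 0"
  shows "nontrivial_2_torsion a b c (Affine x y) \<longleftrightarrow>
    y = 0 \<and> poly (cubic_rhs a b c) x = 0 \<and> poly (pderiv (cubic_rhs a b c)) x \<noteq> 0"
proof -
  have "y = - y \<longleftrightarrow> y = 0"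
    using assms by (metis add.right_inverse mult_2 mult_eq_0_iff neg_equal_0_iff_equal)
  then show ?thesis
    by (auto simp: nontrivial_2_torsion_def Let_def)
qed

text \<open>
  The roots are \<open>x \<plusminus> \<surd>d\<close>; they are distinct because the difference \<open>2 \<surd>d\<close> is nonzero away from
  characteristic 2.
\<close>

lemma square_of_shifted_quadratic_two_double_roots:
  fixes x d :: "'a::field"
  assumes "(2::'a) \<noteq> 0" and "d \<noteq> 0"
  shows "\<exists>s t :: 'a alg_closure. s \<noteq> t \<and>
    map_poly to_ac (([:- x, 1:] ^ 2 - [:d:]) ^ 2) = [:- s, 1:] ^ 2 * [:- t, 1:] ^ 2"
proof -
  obtain w :: "'a alg_closure" where w: "w ^ 2 = to_ac d"
    using nth_root_exists[of 2 "to_ac d"] by auto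
  have "w \<noteq> 0" using w assms(2) by auto
  moreover have "(2::'a alg_closure) \<noteq> 0"
    using assms(1) by (metis to_ac_eq_0_iff to_ac_numeral)
  ultimately have "2 * w \<noteq> 0" by simp
  then have "to_ac x + w \<noteq> to_ac x - w"
    by (auto simp: algebra_simps)
  moreover have "map_poly to_ac (([:- x, 1:] ^ 2 - [:d:]) ^ 2) =
      [:- (to_ac x + w), 1:] ^ 2 * [:- (to_ac x - w), 1:] ^ 2"
  proof -
    have "([:- x, 1:] ^ 2 - [:d:]) ^ 2 = [:x ^ 2 - d, - 2 * x, 1:] * [:x ^ 2 - d, - 2 * x, 1:]"
      by (simp add: power2_eq_square)
    also have "\<dots> = [:(x ^ 2 - d) ^ 2, - 4 * x * (x ^ 2 - d), 4 * x ^ 2 + 2 * (x ^ 2 - d), - 4 * x, 1:]"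
      by (simp add: power2_eq_square algebra_simps)
    also have "map_poly to_ac \<dots> = ([:- (to_ac x + w), 1:] * [:- (to_ac x - w), 1:]) ^ 2"
      by (simp add: map_poly_pCons flip: w) (simp add: power2_eq_square algebra_simps)
    finally show ?thesis by (simp only: power_mult_distrib)
  qed
  ultimately show ?thesis by blast
qed

theorem corollary3:
  fixes q :: "'a::field poly"
  assumes "CHAR('a) \<noteq> 2"
    and "is_two_division_quartic q"
    and "\<not> (\<exists>s. q = [:- s, 1:] ^ 4)"
  shows "(quartic_e q = 0 \<longleftrightarrow>
            (\<exists>a b c x2 y2. nontrivial_2_torsion a b c (Affine x2 y2) \<and>
               q = two_division_quartic a b c x2))
       \<and> ((\<exists>a b c x2 y2. nontrivial_2_torsion a b c (Affine x2 y2) \<and>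
               q = two_division_quartic a b c x2) \<longleftrightarrow>
            (\<exists>s t :: 'a alg_closure. s \<noteq> t \<and>
               map_poly to_ac q = [:- s, 1:] ^ 2 * [:- t, 1:] ^ 2))"
    (is "(?e \<longleftrightarrow> ?torsion) \<and> (_ \<longleftrightarrow> ?double)")
proof -
  have two: "(2::'a) \<noteq> 0"
    using assms(1) by (rule two_neq_zero_if_CHAR_neq_2)
  have e_imp_torsion: ?torsion if ?e
  proof -
    obtain a b c x y where q: "q = two_division_quartic a b c x"
      using assms(2) unfolding is_two_division_quartic_def by blast
    have "(64::'a) = 2 ^ 6" by simp
    with two have "(64::'a) \<noteq> 0" by (metis power_not_zero)
    with \<open>?e\<close> have root: "poly (cubic_rhs a b c) x = 0"
      unfolding q quartic_e_two_division_quartic by simp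
    have "poly (pderiv (cubic_rhs a b c)) x \<noteq> 0"
    proof
      assume "poly (pderiv (cubic_rhs a b c)) x = 0"
      with two_division_quartic_at_root[OF root] have "q = [:- x, 1:] ^ 4"
        unfolding q by (simp flip: power_mult)
      with assms(3) show False by blast
    qed
    with root have "nontrivial_2_torsion a b c (Affine x 0)"
      by (simp add: nontrivial_2_torsion_Affine_iff[OF two])
    with q show ?torsion by blast
  qed
  have torsion_imp_double: ?double if ?torsion
  proof -
    from that obtain a b c x y
      where P: "nontrivial_2_torsion a b c (Affine x y)"
        and q: "q = two_division_quartic a b c x"
      by blast
    from P have root: "poly (cubic_rhs a b c) x = 0"
      and deriv: "poly (pderiv (cubic_rhs a b c)) x \<noteq> 0"
      by (simp_all add: nontrivial_2_torsion_Affine_iff[OF two])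
    show ?double
      unfolding q two_division_quartic_at_root[OF root]
      using square_of_shifted_quadratic_two_double_roots[OF two deriv] .
  qed
  have double_imp_e: ?e if ?double
  proof -
    from that obtain s t :: "'a alg_closure"
      where "map_poly to_ac q = [:- s, 1:] ^ 2 * [:- t, 1:] ^ 2"
      by blast
    also have "\<dots> = [:s * t, - (s + t), 1:] ^ 2"
      by (simp flip: power_mult_distrib add: algebra_simps)
    finally have "to_ac (quartic_e q) = 0"
      by (simp only: quartic_e_square flip: quartic_e_map_poly_to_ac)
    then show ?e by simp
  qed
  show ?thesis
    using e_imp_torsion torsion_imp_double double_imp_e by blast
qed

end
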